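(* There exist two analytic functions $\phi_1,\phi_2\colon\mathbb D\to\mathbb D$ with $|\phi_1^*|=|\phi_2^*|$ $m$-a.e. on $\mathbb T$ such that $C_{\phi_2}\colon H^2\to H^2$ is compact while $C_{\phi_1}\colon H^2\to H^2$ is not compact.
   Context: $H^2$ is the classical Hardy space on the unit disc $\mathbb D$; $\phi^*$ denotes the radial boundary values of a bounded analytic $\phi$; $m$ is normalized Lebesgue measure on $\mathbb T$; $C_\phi f=f\circ\phi$. *)

theory Defs
  imports "HOL-Complex_Analysis.Complex_Analysis"
begin

definition taylor_coeff :: "(complex \<Rightarrow> complex) \<Rightarrow> nat \<Rightarrow> complex" where
  "taylor_coeff f n = (deriv ^^ n) f 0 / of_nat (fact n)"

definition in_H2 :: "(complex \<Rightarrow> complex) \<Rightarrow> bool" where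
  "in_H2 f \<longleftrightarrow> f holomorphic_on ball 0 1 \<and> summable (\<lambda>n. (cmod (taylor_coeff f n))\<^sup>2)"

definition H2_norm :: "(complex \<Rightarrow> complex) \<Rightarrow> real" where
  "H2_norm f = sqrt (\<Sum>n. (cmod (taylor_coeff f n))\<^sup>2)"

definition compact_comp_H2 :: "(complex \<Rightarrow> complex) \<Rightarrow> bool" where
  "compact_comp_H2 \<phi> \<longleftrightarrow>
     (\<forall>f :: nat \<Rightarrow> complex \<Rightarrow> complex.
        (\<forall>n. in_H2 (f n) \<and> H2_norm (f n) \<le> 1) \<longrightarrow>
        (\<exists>r g. strict_mono r \<and> in_H2 g \<and>
               (\<lambda>n. H2_norm (\<lambda>z. f (r n) (\<phi> z) - g z)) \<longlonglongrightarrow> 0))"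

definition disc_self_map :: "(complex \<Rightarrow> complex) \<Rightarrow> bool" where
  "disc_self_map \<phi> \<longleftrightarrow> \<phi> holomorphic_on ball 0 1 \<and> \<phi> ` ball 0 1 \<subseteq> ball 0 1"

end

theory Submission
  imports Defs
begin

text \<open>Take \<open>\<phi>1 z = (1 + z) / 2\<close> and \<open>\<phi>2 = \<phi>1 M\<close> with the singular inner function
  \<open>M z = exp (- (1 + z) / (1 - z))\<close>, which is unimodular on the circle. The symbol \<open>\<phi>1\<close> has an
  angular derivative at 1, so normalised reproducing kernels detect non-compactness. The factor
  \<open>M\<close> spins so fast near 1 that the powers of \<open>\<phi>2\<close> are almost orthogonal: for \<open>n = m + k\<close> the
  inner product of \<open>\<phi>2^n\<close> and \<open>\<phi>2^m\<close> is the \<open>m\<close>-th Taylor coefficient of \<open>\<phi>1^(n + m) M^k\<close>,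
  which Cauchy's estimate bounds by a multiple of \<open>1 / (m k\<^sup>2)\<close>, while the diagonal entries tend to 0.
  Schur's test then makes the tails of the Gram matrix small in operator norm.\<close>

section \<open>Taylor coefficients and circular means\<close>

lemma taylor_coeff_sums:
  assumes "f holomorphic_on ball 0 1" "cmod z < 1"
  shows "(\<lambda>n. taylor_coeff f n * z ^ n) sums f z"
  using holomorphic_power_series[OF assms(1), of z] assms(2)
  by (simp add: taylor_coeff_def)

text \<open>Uniqueness of power series: the expansion on the disc is also the formal power series of
  f at 0, whose coefficients are the normalised derivatives.\<close>

lemma taylor_coeff_eqI:
  assumes "\<And>z. cmod z < 1 \<Longrightarrow> (\<lambda>n. a n * z ^ n) sums f z"
  shows "taylor_coeff f n = a n"
proof -
  have "eventually (\<lambda>u. u \<in> ball 0 1) (nhds (0::complex))"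
    by (intro eventually_nhds_in_open) auto
  then have "f has_fps_expansion (Abs_fps a)"
    by (intro has_fps_expansionI, elim eventually_mono) (use assms in auto)
  from fps_nth_fps_expansion[OF this, of n] show ?thesis
    by (simp add: taylor_coeff_def)
qed

lemma holomorphic_unit_disc_powerI:
  assumes "\<And>z. cmod z < 1 \<Longrightarrow> (\<lambda>n. a n * z ^ n) sums f z"
  shows "f holomorphic_on ball 0 1"
  by (rule power_series_holomorphic[where a = a]) (use assms in auto)

lemma taylor_coeff_diff:
  assumes "f holomorphic_on ball 0 1" "g holomorphic_on ball 0 1"
  shows "taylor_coeff (\<lambda>z. f z - g z) n = taylor_coeff f n - taylor_coeff g n"
  by (rule taylor_coeff_eqI)
    (use taylor_coeff_sums[OF assms(1)] taylor_coeff_sums[OF assms(2)] in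
      \<open>auto intro!: sums_diff simp: left_diff_distrib\<close>)

lemma taylor_coeff_polynomial:
  "taylor_coeff (\<lambda>z. \<Sum>j<J. c j * z ^ j) n = (if n < J then c n else 0)"
proof (rule taylor_coeff_eqI)
  fix z :: complex
  have "(\<lambda>n. (if n < J then c n else 0) * z ^ n) sums (\<Sum>j<J. (if j < J then c j else 0) * z ^ j)"
    by (rule sums_finite) auto
  also have "(\<Sum>j<J. (if j < J then c j else 0) * z ^ j) = (\<Sum>j<J. c j * z ^ j)"
    by (intro sum.cong) auto
  finally show "(\<lambda>n. (if n < J then c n else 0) * z ^ n) sums (\<Sum>j<J. c j * z ^ j)" .
qed

section \<open>Means over circles, Cauchy's formula and Bessel's inequality\<close>

definition circle_pt :: "real \<Rightarrow> complex" where
  "circle_pt t = cis (2 * pi * t)"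

text \<open>With the parameter in \<open>{0..1}\<close> the plain integral is the mean with respect
  to m. The value type is general so that one notion serves complex pairings and real squared
  moduli.\<close>

definition circle_mean :: "(complex \<Rightarrow> 'a::euclidean_space) \<Rightarrow> real \<Rightarrow> 'a" where
  "circle_mean f r = integral {0..1} (\<lambda>t. f (of_real r * circle_pt t))"

abbreviation circle_integrable :: "(complex \<Rightarrow> 'a::euclidean_space) \<Rightarrow> real \<Rightarrow> bool" where
  "circle_integrable f r \<equiv> (\<lambda>t. f (of_real r * circle_pt t)) integrable_on {0..1}"

lemma norm_circle_pt [simp]: "cmod (circle_pt t) = 1"
  by (simp add: circle_pt_def)

lemma continuous_circle_pt [continuous_intros]: "continuous_on A circle_pt"
  unfolding circle_pt_def by (intro continuous_intros)

lemma circle_pt_neq_1: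
  assumes "0 < t" "t < 1"
  shows "circle_pt t \<noteq> 1"
proof
  assume "circle_pt t = 1"
  then have "cos (2 * pi * t) = 1"
    by (simp add: circle_pt_def complex_eq_iff)
  then obtain n :: int where n: "2 * pi * t = of_int n * 2 * pi"
    using cos_one_2pi_int by metis
  then have "t = of_int n" by simp
  with assms show False by simp
qed

lemma circle_integrable_continuous:
  assumes "continuous_on (sphere 0 r) f" "0 \<le> r"
  shows "circle_integrable f r"
  by (intro integrable_continuous_real continuous_on_compose2[OF assms(1)] continuous_intros)
    (use assms(2) in \<open>auto simp: norm_mult\<close>)

text \<open>Cauchy's formula for the n-th derivative, with the contour integral written out in the
  parameter t; the factor z contributed by dz lowers the exponent from \<open>Suc n\<close> to
  n.\<close>

lemma circle_mean_taylor_coeff: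
  assumes holo: "f holomorphic_on ball 0 1" and r: "0 < r" "r < 1"
  shows "circle_mean (\<lambda>z. f z / z ^ n) r = taylor_coeff f n"
proof -
  have *: "((\<lambda>u. f u / (u-0) ^ (Suc n)) has_contour_integral
         ((2 * pi * \<i>) / (fact n) * (deriv ^^ n) f 0)) (circlepath 0 r)"
  proof (rule Cauchy_has_contour_integral_higher_derivative_circlepath)
    show "continuous_on (cball 0 r) f"
      using holo r by (intro holomorphic_on_imp_continuous_on) (auto elim!: holomorphic_on_subset)
    show "f holomorphic_on ball 0 r"
      using r by (intro holomorphic_on_subset[OF holo]) auto
  qed (use r in auto)
  have e: "circlepath 0 r t = of_real r * circle_pt t" for t
    by (simp add: circlepath circle_pt_def cis_conv_exp mult_ac)
  have "((\<lambda>t. f (of_real r * circle_pt t) / (of_real r * circle_pt t) ^ Suc n *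
          (2 * pi * \<i> * r * exp (2 * of_real pi * \<i> * t))) has_integral
          ((2 * pi * \<i>) / (fact n) * (deriv ^^ n) f 0)) {0..1}"
    using * unfolding has_contour_integral_def
    by (rule has_integral_eq[rotated]) (simp add: e vector_derivative_circlepath01)
  then have "((\<lambda>t. (2 * pi * \<i>) * (f (of_real r * circle_pt t) / (of_real r * circle_pt t) ^ n)) has_integral
          ((2 * pi * \<i>) * taylor_coeff f n)) {0..1}"
  proof (rule has_integral_eq_rhs[OF has_integral_eq[rotated]])
    fix t
    have "circle_pt t \<noteq> 0" using norm_circle_pt[of t] by fastforce
    moreover have "exp (2 * of_real pi * \<i> * t) = circle_pt t"
      by (simp add: circle_pt_def cis_conv_exp mult_ac)
    ultimately show "f (of_real r * circle_pt t) / (of_real r * circle_pt t) ^ Suc n *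
          (2 * pi * \<i> * r * exp (2 * of_real pi * \<i> * t)) =
          (2 * pi * \<i>) * (f (of_real r * circle_pt t) / (of_real r * circle_pt t) ^ n)"
      using r by (simp add: field_simps)
  qed (simp add: taylor_coeff_def)
  from has_integral_mult_right[OF this, of "1 / (2 * pi * \<i>)"]
  show ?thesis
    unfolding circle_mean_def by (intro integral_unique) simp
qed

lemma norm_circle_mean_le:
  fixes f :: "complex \<Rightarrow> 'a::euclidean_space"
  assumes "\<And>z. cmod z = r \<Longrightarrow> norm (f z) \<le> B" "0 \<le> r"
  shows "norm (circle_mean f r) \<le> B"
proof (cases "circle_integrable f r")
  case True
  have "norm (circle_mean f r) \<le> integral {0..1::real} (\<lambda>t. B)"
    unfolding circle_mean_def
    by (intro integral_norm_bound_integral True) (use assms in \<open>auto simp: norm_mult\<close>)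
  then show ?thesis by simp
next
  case False
  \<comment> \<open>The integral of a non-integrable function is 0 by convention, so here only the
    sign of \<open>B\<close> matters.\<close>
  have "0 \<le> B"
    using assms(1)[of "of_real r"] assms(2) order_trans[OF norm_ge_zero] by simp
  then show ?thesis
    using False by (simp add: circle_mean_def not_integrable_integral)
qed

lemma norm_taylor_coeff_le:
  assumes "f holomorphic_on ball 0 1" "0 < r" "r < 1"
    and "\<And>z. cmod z = r \<Longrightarrow> cmod (f z) / r ^ n \<le> B"
  shows "cmod (taylor_coeff f n) \<le> B"
  unfolding circle_mean_taylor_coeff[OF assms(1-3), symmetric]
  by (rule norm_circle_mean_le) (use assms in \<open>auto simp: norm_divide norm_power\<close>)

lemma Re_circle_mean:
  assumes "circle_integrable f r"
  shows "Re (circle_mean f r) = circle_mean (\<lambda>z. Re (f z)) r"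
  unfolding circle_mean_def
  using integral_linear[OF assms bounded_linear_Re] by (simp add: o_def)

lemma circle_mean_linear_combination:
  fixes f :: "'i \<Rightarrow> complex \<Rightarrow> complex"
  assumes "finite A" "\<And>i. i \<in> A \<Longrightarrow> circle_integrable (f i) r"
  shows "circle_integrable (\<lambda>z. \<Sum>i\<in>A. c i * f i z) r"
    and "circle_mean (\<lambda>z. \<Sum>i\<in>A. c i * f i z) r = (\<Sum>i\<in>A. c i * circle_mean (f i) r)"
proof -
  have "((\<lambda>t. \<Sum>i\<in>A. c i * f i (of_real r * circle_pt t)) has_integral
      (\<Sum>i\<in>A. c i * circle_mean (f i) r)) {0..1}"
    unfolding circle_mean_def
    by (intro has_integral_sum has_integral_mult_right integrable_integral assms)
  then show "circle_integrable (\<lambda>z. \<Sum>i\<in>A. c i * f i z) r"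
    and "circle_mean (\<lambda>z. \<Sum>i\<in>A. c i * f i z) r = (\<Sum>i\<in>A. c i * circle_mean (f i) r)"
    by (auto simp: circle_mean_def integral_unique)
qed

text \<open>For the Taylor polynomial \<open>S\<close> of f, the pairings of f with \<open>S\<close>
  and of \<open>S\<close> with itself both equal the left-hand sum, so integrating |f - S|^2 \<ge> 0
  gives the claim.\<close>

lemma Bessel_inequality_circle:
  assumes holo: "f holomorphic_on ball 0 1" and r: "0 < r" "r < 1"
  shows "(\<Sum>j<J. (cmod (taylor_coeff f j))\<^sup>2 * r ^ (2 * j)) \<le> circle_mean (\<lambda>z. (cmod (f z))\<^sup>2) r"
proof -
  define S where "S z = (\<Sum>j<J. taylor_coeff f j * z ^ j)" for z
  have holS: "S holomorphic_on ball 0 1"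
    unfolding S_def by (intro holomorphic_intros)
  have cont: "continuous_on (sphere 0 r) h" if "h holomorphic_on ball 0 1" for h :: "complex \<Rightarrow> complex"
    using holomorphic_on_imp_continuous_on[OF that] by (rule continuous_on_subset) (use r in auto)
  have pair: "circle_mean (\<lambda>z. h z * cnj (S z)) r =
      (\<Sum>j<J. taylor_coeff h j * cnj (taylor_coeff f j) * r ^ (2 * j))"
    if h: "h holomorphic_on ball 0 1" for h
  proof -
    have int: "circle_integrable (\<lambda>z. h z / z ^ j) r" for j
      by (intro circle_integrable_continuous continuous_intros cont h) (use r in auto)
    \<comment> \<open>On this circle \<open>cnj z\<close> equals r^2 / z, which turns the pairing
      with \<open>S\<close> into a combination of Cauchy integrals for the coefficients of
      h.\<close>
    have "cnj z ^ j = r ^ (2 * j) / z ^ j" if "cmod z = r" for z :: complex and j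
    proof -
      have "z * cnj z = (of_real r)\<^sup>2"
        using that complex_norm_square[of z] by simp
      then have "z ^ j * cnj z ^ j = (of_real r)\<^sup>2 ^ j"
        by (metis power_mult_distrib)
      then have "z ^ j * cnj z ^ j = of_real r ^ (2 * j)"
        by (simp only: power_mult)
      moreover have "z ^ j \<noteq> 0" using that r by auto
      ultimately show ?thesis by (simp add: eq_divide_eq mult.commute)
    qed
    then have "h z * cnj (S z) = (\<Sum>j<J. (cnj (taylor_coeff f j) * r ^ (2 * j)) * (h z / z ^ j))"
      if "cmod z = r" for z
      using that by (simp add: S_def sum_distrib_left mult_ac)
    then have "circle_mean (\<lambda>z. h z * cnj (S z)) r =
       circle_mean (\<lambda>z. \<Sum>j<J. (cnj (taylor_coeff f j) * r ^ (2 * j)) * (h z / z ^ j)) r"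
      unfolding circle_mean_def by (intro integral_cong) (use r in \<open>simp add: norm_mult\<close>)
    also have "\<dots> = (\<Sum>j<J. (cnj (taylor_coeff f j) * r ^ (2 * j)) * circle_mean (\<lambda>z. h z / z ^ j) r)"
      using int by (intro circle_mean_linear_combination) auto
    also have "\<dots> = (\<Sum>j<J. taylor_coeff h j * cnj (taylor_coeff f j) * r ^ (2 * j))"
      using circle_mean_taylor_coeff[OF h r] by (simp add: mult_ac)
    finally show ?thesis .
  qed
  define X where "X = (\<Sum>j<J. (cmod (taylor_coeff f j))\<^sup>2 * r ^ (2 * j))"
  have sq: "c * cnj c = of_real ((cmod c)\<^sup>2)" for c
    by (metis complex_norm_square of_real_power)
  have 1: "circle_mean (\<lambda>z. f z * cnj (S z)) r = of_real X"
    unfolding pair[OF holo] X_def by (simp add: sq)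
  have "taylor_coeff S j = taylor_coeff f j" if "j < J" for j
    using taylor_coeff_polynomial[of "taylor_coeff f" J j] that by (simp add: S_def[abs_def])
  then have 2: "circle_mean (\<lambda>z. S z * cnj (S z)) r = of_real X"
    unfolding pair[OF holS] X_def by (simp add: sq)
  have ifS: "circle_integrable (\<lambda>z. f z * cnj (S z)) r"
    and iSS: "circle_integrable (\<lambda>z. S z * cnj (S z)) r"
    and iff: "circle_integrable (\<lambda>z. (cmod (f z))\<^sup>2) r"
    by (intro circle_integrable_continuous continuous_intros cont holo holS; use r in simp)+
  have r1: "circle_mean (\<lambda>z. Re (f z * cnj (S z))) r = X"
    using Re_circle_mean[OF ifS] 1 by simp
  have r2: "circle_mean (\<lambda>z. Re (S z * cnj (S z))) r = X"
    using Re_circle_mean[OF iSS] 2 by simp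
  have iR: "circle_integrable (\<lambda>z. Re (f z * cnj (S z))) r"
    "circle_integrable (\<lambda>z. Re (S z * cnj (S z))) r"
    by (intro circle_integrable_continuous continuous_intros cont holo holS; use r in simp)+
  \<comment> \<open>This is |a - b|^2 \<ge> 0, expanded.\<close>
  have pt: "2 * Re (a * cnj b) - Re (b * cnj b) \<le> (cmod a)\<^sup>2" for a b :: complex
    using zero_le_power2[of "Re a - Re b"] zero_le_power2[of "Im a - Im b"]
    unfolding cmod_power2 by (simp add: power2_eq_square algebra_simps)
  define u where "u t = Re (f (of_real r * circle_pt t) * cnj (S (of_real r * circle_pt t)))" for t
  define v where "v t = Re (S (of_real r * circle_pt t) * cnj (S (of_real r * circle_pt t)))" for t
  have "(u has_integral X) {0..1}" "(v has_integral X) {0..1}"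
    using iR r1 r2 unfolding circle_mean_def has_integral_iff u_def[abs_def] v_def[abs_def] by blast+
  then have uv: "((\<lambda>t. 2 * u t - v t) has_integral 2 * X - X) {0..1}"
    by (intro has_integral_diff has_integral_mult_right)
  have "2 * X - X \<le> circle_mean (\<lambda>z. (cmod (f z))\<^sup>2) r"
    unfolding circle_mean_def
    by (rule has_integral_le[OF uv integrable_integral[OF iff]]) (simp only: u_def v_def pt)
  then show ?thesis by (simp add: X_def)
qed

section \<open>Passage from interior circles to the unit circle\<close>

definition radii :: "nat \<Rightarrow> real" where "radii k = 1 - 1 / real (k + 2)"

lemma radii_bounds: "1 / 2 \<le> radii k" "radii k < 1" "0 < radii k"
  by (auto simp: radii_def field_simps)

lemma radii_tendsto: "radii \<longlonglongrightarrow> 1"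
  unfolding radii_def by real_asymp

text \<open>Dominated convergence with the constant \<open>B\<close>. The point 1, where the symbols
  to come may be singular, is hit only at the parameters 0 and 1, which the open interval discards.
  The lower bound 1/2 on the modulus keeps quotients by powers of z bounded.\<close>

lemma circle_mean_radial_limit:
  fixes F :: "complex \<Rightarrow> 'a::euclidean_space"
  assumes cont: "continuous_on {z. 1 / 2 \<le> cmod z \<and> cmod z \<le> 1 \<and> z \<noteq> 1} F"
    and bd: "\<And>z. 1 / 2 \<le> cmod z \<Longrightarrow> cmod z \<le> 1 \<Longrightarrow> z \<noteq> 1 \<Longrightarrow> norm (F z) \<le> B"
  shows "circle_integrable F 1" "(\<lambda>k. circle_mean F (radii k)) \<longlonglongrightarrow> circle_mean F 1"
proof -
  let ?S = "{z. 1 / 2 \<le> cmod z \<and> cmod z \<le> 1 \<and> z \<noteq> 1}"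
  let ?f = "\<lambda>k t. F (of_real (radii k) * circle_pt t)"
  have in_S: "of_real (radii k) * circle_pt t \<in> ?S" for k t
  proof -
    have n: "cmod (of_real (radii k) * circle_pt t) = radii k"
      using radii_bounds[of k] by (simp add: norm_mult)
    with radii_bounds[of k] show ?thesis by (auto simp del: norm_mult)
  qed
  have 1: "?f k integrable_on {0<..<1}" for k
    unfolding integrable_on_open_interval_real
  proof (rule integrable_continuous_real)
    show "continuous_on {0..1} (?f k)"
      by (rule continuous_on_compose2[OF cont]) (use in_S in \<open>auto intro!: continuous_intros\<close>)
  qed
  have 2: "(\<lambda>t. B) integrable_on {0<..<1::real}"
    unfolding integrable_on_open_interval_real by (rule integrable_const_ivl)
  have 3: "norm (?f k t) \<le> B" for k t
    using in_S[of k t] bd by blast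
  have 4: "(\<lambda>k. ?f k t) \<longlonglongrightarrow> F (circle_pt t)" if "t \<in> {0<..<1}" for t
  proof -
    have "circle_pt t \<in> ?S" using circle_pt_neq_1 that by auto
    moreover have "(\<lambda>k. of_real (radii k) * circle_pt t) \<longlonglongrightarrow> of_real 1 * circle_pt t"
      by (intro tendsto_intros radii_tendsto)
    ultimately show ?thesis
      using continuous_on_tendsto_compose[OF cont, of "\<lambda>k. of_real (radii k) * circle_pt t" "circle_pt t" sequentially] in_S
      by auto
  qed
  note lim = dominated_convergence[of ?f "{0<..<1}" "\<lambda>t. B", OF 1 2 3 4]
  from lim(1) show "circle_integrable F 1"
    by (simp add: integrable_on_open_interval_real)
  from lim(2) show "(\<lambda>k. circle_mean F (radii k)) \<longlonglongrightarrow> circle_mean F 1"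
    unfolding circle_mean_def integral_open_interval_real by simp
qed

text \<open>Bessel's inequality holds on every circle of radius \<open>radii k\<close>; both sides
  have a limit as the radius tends to 1, the left one because it is a finite sum.\<close>

lemma sum_taylor_coeff_le_boundary_mean:
  assumes holo: "f holomorphic_on ball 0 1"
    and cont: "continuous_on {z. 1 / 2 \<le> cmod z \<and> cmod z \<le> 1 \<and> z \<noteq> 1} f"
    and bd: "\<And>z. 1 / 2 \<le> cmod z \<Longrightarrow> cmod z \<le> 1 \<Longrightarrow> z \<noteq> 1 \<Longrightarrow> cmod (f z) \<le> B"
  shows "(\<Sum>j<J. (cmod (taylor_coeff f j))\<^sup>2) \<le> circle_mean (\<lambda>z. (cmod (f z))\<^sup>2) 1"
proof (rule LIMSEQ_le)
  show "(\<lambda>k. \<Sum>j<J. (cmod (taylor_coeff f j))\<^sup>2 * radii k ^ (2 * j))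
      \<longlonglongrightarrow> (\<Sum>j<J. (cmod (taylor_coeff f j))\<^sup>2)"
    by (rule tendsto_eq_intros radii_tendsto refl | simp)+
  show "(\<lambda>k. circle_mean (\<lambda>z. (cmod (f z))\<^sup>2) (radii k)) \<longlonglongrightarrow> circle_mean (\<lambda>z. (cmod (f z))\<^sup>2) 1"
    by (rule circle_mean_radial_limit(2)[where B = "B\<^sup>2"])
      (auto intro!: continuous_on_power continuous_on_norm cont[simplified] power_mono bd)
  show "\<exists>N. \<forall>k\<ge>N. (\<Sum>j<J. (cmod (taylor_coeff f j))\<^sup>2 * radii k ^ (2 * j))
      \<le> circle_mean (\<lambda>z. (cmod (f z))\<^sup>2) (radii k)"
    using Bessel_inequality_circle[OF holo radii_bounds(3,2)] by blast
qed

section \<open>The two symbols\<close>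

definition singular_inner :: "complex \<Rightarrow> complex" where
  "singular_inner z = exp (- ((1 + z) / (1 - z)))"

definition affine_symbol :: "complex \<Rightarrow> complex" where
  "affine_symbol z = (1 + z) / 2"

definition twisted_symbol :: "complex \<Rightarrow> complex" where
  "twisted_symbol z = affine_symbol z * singular_inner z"

text \<open>The real part of (1 + z) / (1 - z) is the Poisson kernel at 1. The formula survives at z
  = 1, where division by zero makes both sides equal to 1.\<close>

lemma norm_singular_inner:
  "cmod (singular_inner z) = exp (- ((1 - (cmod z)\<^sup>2) / (cmod (1 - z))\<^sup>2))"
proof -
  have "Re ((1 + z) / (1 - z)) = (1 - (cmod z)\<^sup>2) / (cmod (1 - z))\<^sup>2"
    unfolding cmod_power2 Re_divide by (simp add: power2_eq_square algebra_simps)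
  then show ?thesis by (simp add: singular_inner_def)
qed

lemma norm_singular_inner_le_1: "cmod z \<le> 1 \<Longrightarrow> cmod (singular_inner z) \<le> 1"
  by (simp add: norm_singular_inner power_le_one)

lemma norm_singular_inner_circle: "cmod z = 1 \<Longrightarrow> cmod (singular_inner z) = 1"
  by (simp add: norm_singular_inner)

lemma norm_affine_symbol_le: "cmod (affine_symbol z) \<le> (1 + cmod z) / 2"
  using norm_triangle_ineq[of 1 z] by (simp add: affine_symbol_def norm_divide)

lemma norm_twisted_symbol_le: "cmod z \<le> 1 \<Longrightarrow> cmod (twisted_symbol z) \<le> (1 + cmod z) / 2"
  using mult_mono[OF norm_affine_symbol_le[of z] norm_singular_inner_le_1[of z]]
  by (simp add: twisted_symbol_def norm_mult)

text \<open>By the parallelogram law |1 + z|^2 = 4 - |1 - z|^2 on the circle.\<close>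

lemma norm_affine_symbol_less_1:
  assumes "cmod z = 1" "z \<noteq> 1"
  shows "cmod (affine_symbol z) < 1"
proof -
  have "(cmod (1 + z))\<^sup>2 + (cmod (1 - z))\<^sup>2 = 2 + 2 * (cmod z)\<^sup>2"
    unfolding cmod_power2 by (simp add: power2_eq_square algebra_simps)
  moreover have "(cmod (1 - z))\<^sup>2 > 0" using assms by simp
  ultimately have "(cmod (1 + z))\<^sup>2 < 2\<^sup>2" unfolding assms(1) power2_eq_square by linarith
  then have "cmod (1 + z) < 2" by (rule power_less_imp_less_base) simp
  then show ?thesis by (simp add: affine_symbol_def norm_divide)
qed

lemma holomorphic_affine_symbol [holomorphic_intros]: "affine_symbol holomorphic_on A"
  unfolding affine_symbol_def by (intro holomorphic_intros) auto

lemma holomorphic_singular_inner: "1 \<notin> A \<Longrightarrow> singular_inner holomorphic_on A"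
  unfolding singular_inner_def by (intro holomorphic_intros) auto

lemma holomorphic_twisted_symbol: "1 \<notin> A \<Longrightarrow> twisted_symbol holomorphic_on A"
  unfolding twisted_symbol_def by (intro holomorphic_intros holomorphic_singular_inner)

lemma continuous_twisted_symbol: "1 \<notin> A \<Longrightarrow> continuous_on A twisted_symbol"
  by (intro holomorphic_on_imp_continuous_on holomorphic_twisted_symbol)

lemma disc_self_map_affine_symbol: "disc_self_map affine_symbol"
  unfolding disc_self_map_def
  by (auto intro!: holomorphic_affine_symbol le_less_trans[OF norm_affine_symbol_le])

lemma disc_self_map_twisted_symbol: "disc_self_map twisted_symbol"
  unfolding disc_self_map_def
  by (auto intro!: holomorphic_twisted_symbol le_less_trans[OF norm_twisted_symbol_le])

section \<open>The Gram matrix of the powers of the twisted symbol\<close>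

text \<open>The inner product, in L^2 of the circle, of two powers of the boundary function of
  \<open>twisted_symbol\<close>. The formula for the symbol makes sense on the circle, so the radius
  is 1 and no limit is taken.\<close>

definition gram :: "nat \<Rightarrow> nat \<Rightarrow> complex" where
  "gram n m = circle_mean (\<lambda>z. twisted_symbol z ^ n * cnj (twisted_symbol z ^ m)) 1"

lemma norm_twisted_symbol_le_1: "cmod z \<le> 1 \<Longrightarrow> cmod (twisted_symbol z) \<le> 1"
  using norm_twisted_symbol_le[of z] by simp

lemma gram_integrable: "circle_integrable (\<lambda>z. twisted_symbol z ^ n * cnj (twisted_symbol z ^ m)) 1"
  by (rule circle_mean_radial_limit(1)[where B = 1])
    (auto intro!: continuous_intros continuous_twisted_symbol mult_le_one power_le_one norm_twisted_symbol_le_1 simp: norm_mult norm_power)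

lemma norm_gram_commute: "cmod (gram n m) = cmod (gram m n)"
proof -
  have "gram n m = cnj (gram m n)"
    unfolding gram_def circle_mean_def integral_cnj by (simp add: mult.commute)
  then show ?thesis by simp
qed

text \<open>On the unit circle the conjugate of the affine symbol is its quotient by \<open>z\<close>, and the
  singular inner factor has modulus one; thus the integrand is the boundary value of a
  meromorphic function whose only pole in the disc is at the origin.\<close>

lemma gram_eq_taylor_coeff:
  "gram (m + k) m = taylor_coeff (\<lambda>z. affine_symbol z ^ (2 * m + k) * singular_inner z ^ k) m"
proof -
  define H where "H z = affine_symbol z ^ (2 * m + k) * singular_inner z ^ k" for z
  have eq: "twisted_symbol z ^ (m + k) * cnj (twisted_symbol z ^ m) = H z / z ^ m"
    if z: "cmod z = 1" for z
  proof -
    have z0: "z \<noteq> 0" and "z * cnj z = 1"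
      using z complex_norm_square[of z] by auto
    then have "cnj z = 1 / z" by (simp add: field_simps)
    then have a: "cnj (affine_symbol z) = affine_symbol z / z"
      using z0 by (simp add: affine_symbol_def field_simps)
    have "singular_inner z * cnj (singular_inner z) = 1"
      using norm_singular_inner_circle[OF z] complex_norm_square[of "singular_inner z"] by simp
    then have "singular_inner z ^ m * cnj (singular_inner z) ^ m = 1"
      by (metis power_mult_distrib power_one)
    then show ?thesis
      unfolding H_def twisted_symbol_def
      by (simp add: a power_mult_distrib power_add power_divide power_mult power2_eq_square mult_ac)
  qed
  have holH: "H holomorphic_on ball 0 1"
    unfolding H_def by (intro holomorphic_intros holomorphic_singular_inner) auto
  \<comment> \<open>The rewriting of the integrand is valid only at radius 1, while Cauchy's formula
    is used at radii below 1. The interior means of \<open>H z / z ^ m\<close> all equal the same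
    coefficient, so their limit is that coefficient.\<close>
  have "(\<lambda>i. circle_mean (\<lambda>z. H z / z ^ m) (radii i)) \<longlonglongrightarrow> circle_mean (\<lambda>z. H z / z ^ m) 1"
  proof (rule circle_mean_radial_limit(2))
    show "continuous_on {z. 1 / 2 \<le> cmod z \<and> cmod z \<le> 1 \<and> z \<noteq> 1} (\<lambda>z. H z / z ^ m)"
      unfolding H_def
      by (intro holomorphic_on_imp_continuous_on holomorphic_intros holomorphic_singular_inner) auto
    fix z :: complex
    assume z: "1 / 2 \<le> cmod z" "cmod z \<le> 1"
    have "cmod (H z) \<le> 1"
      unfolding H_def norm_mult norm_power
      using z norm_singular_inner_le_1[of z] norm_affine_symbol_le[of z]
      by (intro mult_le_one power_le_one) auto
    moreover have "(1 / 2) ^ m \<le> cmod z ^ m"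
      using z by (intro power_mono) auto
    ultimately show "norm (H z / z ^ m) \<le> 1 / (1 / 2) ^ m"
      unfolding norm_divide norm_power by (intro frac_le) auto
  qed
  then have "circle_mean (\<lambda>z. H z / z ^ m) 1 = taylor_coeff H m"
    using circle_mean_taylor_coeff[OF holH radii_bounds(3,2)] by (simp add: LIMSEQ_const_iff)
  moreover have "gram (m + k) m = circle_mean (\<lambda>z. H z / z ^ m) 1"
    unfolding gram_def circle_mean_def by (intro integral_cong) (simp add: eq del: complex_cnj_power)
  ultimately show ?thesis by (simp add: H_def[abs_def])
qed

text \<open>The fourth power of u/4 \<le> exp (u/4). Order four is what matches u^4 \<ge> m k^2 in
  the estimate below.\<close>

lemma exp_ge_fourth_power:
  assumes "0 \<le> (u::real)"
  shows "u ^ 4 / 256 \<le> exp u"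
proof -
  have "(u / 4) ^ 4 \<le> exp (u / 4) ^ 4"
    using assms exp_ge_add_one_self[of "u / 4"] by (intro power_mono) linarith+
  also have "\<dots> = exp u"
    using exp_of_nat_mult[of 4 "u / 4"] by simp
  finally show ?thesis by (simp add: power_divide)
qed

text \<open>Cauchy's estimate on the circle of radius \<open>1 - 1 / sqrt m\<close>. With \<open>x = |1 - z|\<^sup>2\<close>, the
  affine factor contributes at most \<open>exp (1 - m x / 4)\<close> and the singular factor at most
  \<open>exp (- k / (x sqrt m))\<close>; by AM-GM the product is at most \<open>exp (1 - u)\<close> with \<open>u^4 \<ge> m k\<^sup>2\<close>.\<close>

lemma norm_gram_off_diagonal_le:
  assumes m: "4 \<le> m" and k: "1 \<le> k"
  shows "cmod (gram (m + k) m) \<le> 768 / (real m * (real k)\<^sup>2)"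
  unfolding gram_eq_taylor_coeff
proof (rule norm_taylor_coeff_le)
  \<comment> \<open>With m \<delta>^2 = 1, the error \<delta>^2 in the exponent grows to a mere
    factor e after m powers; m \<ge> 4 keeps the radius at least 1/2.\<close>
  define \<delta> where "\<delta> = 1 / sqrt m"
  have "2 \<le> sqrt m" using m by (intro real_le_rsqrt) simp
  then have \<delta>: "0 < \<delta>" "\<delta> \<le> 1 / 2" and m\<delta>: "m * \<delta>\<^sup>2 = 1"
    using m by (auto simp: \<delta>_def power_divide field_simps)
  define r where "r = 1 - \<delta>"
  show r: "0 < r" "r < 1" using \<delta> by (auto simp: r_def)
  have r2: "1 / 2 \<le> r" using \<delta> by (simp add: r_def)
  show "(\<lambda>z. affine_symbol z ^ (2 * m + k) * singular_inner z ^ k) holomorphic_on ball 0 1"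
    by (intro holomorphic_intros holomorphic_singular_inner) auto
  fix z :: complex
  assume z: "cmod z = r"
  define x where "x = (cmod (1 - z))\<^sup>2"
  have x: "0 < x" using z r by (auto simp: x_def)
  have "(cmod (1 + z))\<^sup>2 + x = 2 + 2 * (cmod z)\<^sup>2"
    unfolding x_def cmod_power2 by (simp add: power2_eq_square algebra_simps)
  \<comment> \<open>Since (1 + r^2) / 2 = r + \<delta>^2 / 2, dividing by r leaves an error of
    second order only.\<close>
  then have "(cmod (affine_symbol z))\<^sup>2 = r + (\<delta>\<^sup>2 / 2 - x / 4)"
    by (simp add: z affine_symbol_def norm_divide power_divide r_def power2_eq_square field_simps)
  then have "(cmod (affine_symbol z))\<^sup>2 / r = 1 + (\<delta>\<^sup>2 / (2 * r) - x / (4 * r))"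
    using r by (simp add: field_simps)
  also have "\<dots> \<le> 1 + (\<delta>\<^sup>2 - x / 4)"
  proof -
    have "\<delta>\<^sup>2 / (2 * r) \<le> \<delta>\<^sup>2 / 1" by (rule divide_left_mono) (use r2 r in auto)
    moreover have "x / 4 \<le> x / (4 * r)" by (rule divide_left_mono) (use x r in auto)
    ultimately show ?thesis by simp
  qed
  also have "\<dots> \<le> exp (\<delta>\<^sup>2 - x / 4)" by (rule exp_ge_add_one_self)
  finally have A: "(cmod (affine_symbol z))\<^sup>2 / r \<le> exp (\<delta>\<^sup>2 - x / 4)" .
  have "\<delta> \<le> 1 - r\<^sup>2"
    using \<delta> by (simp add: r_def power2_eq_square algebra_simps)
  then have "\<delta> / x \<le> (1 - r\<^sup>2) / x" using x by (simp add: divide_right_mono)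
  then have I: "cmod (singular_inner z) \<le> exp (- (\<delta> / x))"
    by (simp add: norm_singular_inner z x_def)
  define u where "u = m * x / 4 + k * \<delta> / x"
  have u0: "0 < u" using m k x \<delta> unfolding u_def by (intro add_pos_pos divide_pos_pos mult_pos_pos) auto
  \<comment> \<open>AM-GM for the two summands of \<open>u\<close>, whose product m k \<delta> / 4
    is free of x.\<close>
  have "0 \<le> (m * x / 4 - k * \<delta> / x)\<^sup>2" by simp
  also have "\<dots> = u\<^sup>2 - m * k * \<delta>"
    using x by (simp add: u_def power2_eq_square field_simps)
  finally have "m * k * \<delta> \<le> u\<^sup>2" by simp
  then have "(m * k * \<delta>)\<^sup>2 \<le> (u\<^sup>2)\<^sup>2"
    using \<delta> by (intro power_mono) auto
  moreover have "(m * k * \<delta>)\<^sup>2 = m * (real k)\<^sup>2"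
  proof -
    have "(m * k * \<delta>)\<^sup>2 = (m * \<delta>\<^sup>2) * (m * (real k)\<^sup>2)" by (simp add: power2_eq_square)
    then show ?thesis by (simp add: m\<delta>)
  qed
  ultimately have u4: "m * (real k)\<^sup>2 \<le> u ^ 4" by simp
  have "cmod (affine_symbol z ^ (2 * m + k) * singular_inner z ^ k) / r ^ m
      = ((cmod (affine_symbol z))\<^sup>2 / r) ^ m * cmod (affine_symbol z) ^ k * cmod (singular_inner z) ^ k"
    by (simp add: norm_mult norm_power power_add power_mult power_divide)
  \<comment> \<open>Of the 2 m + k affine factors, m pairs absorb r ^ m; the remaining k are bounded
    by 1.\<close>
  also have "\<dots> \<le> exp (\<delta>\<^sup>2 - x / 4) ^ m * 1 * exp (- (\<delta> / x)) ^ k"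
    using A I r norm_affine_symbol_le[of z] z
    by (intro mult_mono power_mono power_le_one) auto
  also have "\<dots> = exp (1 - u)"
  proof -
    have "exp (\<delta>\<^sup>2 - x / 4) ^ m * exp (- (\<delta> / x)) ^ k = exp (m * (\<delta>\<^sup>2 - x / 4) + k * (- (\<delta> / x)))"
      by (simp only: exp_of_nat_mult exp_add)
    also have "m * (\<delta>\<^sup>2 - x / 4) + k * (- (\<delta> / x)) = m * \<delta>\<^sup>2 - u"
      by (simp add: u_def algebra_simps)
    finally show ?thesis by (simp add: m\<delta>)
  qed
  also have "\<dots> = exp 1 / exp u" by (simp add: exp_diff)
  \<comment> \<open>Here e \<le> 3, and 768 = 3 * 256.\<close>
  also have "\<dots> \<le> 3 / (u ^ 4 / 256)"
    using exp_le exp_ge_fourth_power[of u] u0 by (intro frac_le) auto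
  also have "\<dots> = 768 / u ^ 4" by simp
  also have "\<dots> \<le> 768 / (real m * (real k)\<^sup>2)"
    using u4 u0 m k by (intro divide_left_mono mult_pos_pos) auto
  finally show "cmod (affine_symbol z ^ (2 * m + k) * singular_inner z ^ k) / r ^ m
      \<le> 768 / (real m * (real k)\<^sup>2)" .
qed

text \<open>Off the point 1 the boundary values have modulus below 1, so the integrand tends to 0
  pointwise; it is dominated by 1.\<close>

lemma gram_diagonal_tendsto_0: "(\<lambda>n. gram n n) \<longlonglongrightarrow> 0"
proof -
  let ?f = "\<lambda>n t. twisted_symbol (circle_pt t) ^ n * cnj (twisted_symbol (circle_pt t) ^ n)"
  have 1: "?f n integrable_on {0<..<1}" for n
    using gram_integrable[of n n] by (simp add: integrable_on_open_interval_real)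
  have 2: "(\<lambda>t. 1 :: real) integrable_on {0<..<1::real}"
    by (simp add: integrable_on_open_interval_real integrable_const_ivl)
  have 3: "norm (?f n t) \<le> 1" for n t
    by (auto simp: norm_mult norm_power intro!: mult_le_one power_le_one norm_twisted_symbol_le_1)
  have 4: "(\<lambda>n. ?f n t) \<longlonglongrightarrow> 0" if "t \<in> {0<..<1}" for t
  proof -
    have "cmod (twisted_symbol (circle_pt t)) < 1"
      using norm_affine_symbol_less_1[of "circle_pt t"] circle_pt_neq_1[of t] that
      by (simp add: twisted_symbol_def norm_mult norm_singular_inner_circle)
    then have "(\<lambda>n. twisted_symbol (circle_pt t) ^ n) \<longlonglongrightarrow> 0"
      by (rule LIMSEQ_power_zero)
    then have "(\<lambda>n. twisted_symbol (circle_pt t) ^ n * cnj (twisted_symbol (circle_pt t) ^ n)) \<longlonglongrightarrow> 0 * cnj 0"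
      by (intro tendsto_mult tendsto_cnj)
    then show ?thesis by simp
  qed
  show ?thesis
    using dominated_convergence(2)[of ?f "{0<..<1}" "\<lambda>t. 1", OF 1 2 3 4]
    by (simp add: gram_def circle_mean_def integral_open_interval_real)
qed

section \<open>Row sums of the Gram matrix and Schur's test\<close>

lemma sum_gram_off_diagonal_le:
  assumes N: "4 \<le> N" and A: "finite A" "A \<subseteq> {N..}" and n: "n \<in> A"
  shows "(\<Sum>m\<in>A - {n}. cmod (gram n m)) \<le> 1536 * (\<Sum>k. 1 / (real k)\<^sup>2) / N"
proof -
  let ?q = "\<lambda>k::nat. 1 / (real k)\<^sup>2"
  \<comment> \<open>The term k = 0 is 1 / 0 = 0 by convention, so the series is the sum of the
    inverse squares.\<close>
  have sm: "summable ?q"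
    using inverse_power_summable[of 2, where 'a = real] by (simp add: inverse_eq_divide)
  \<comment> \<open>\<open>h\<close> will be the distance of m from n, injective on either side of
    n; each side is then dominated by the whole series.\<close>
  have sum_le: "(\<Sum>m\<in>B. cmod (gram n m)) \<le> 768 / N * (\<Sum>k. ?q k)"
    if "finite B" "inj_on h B" "\<And>m. m \<in> B \<Longrightarrow> cmod (gram n m) \<le> 768 / N * ?q (h m)" for B h
  proof -
    have "(\<Sum>m\<in>B. cmod (gram n m)) \<le> 768 / N * (\<Sum>m\<in>B. ?q (h m))"
      unfolding sum_distrib_left using that(3) by (rule sum_mono)
    also have "(\<Sum>m\<in>B. ?q (h m)) = (\<Sum>k\<in>h ` B. ?q k)"
      using that(2) by (simp add: sum.reindex)
    also have "768 / N * \<dots> \<le> 768 / N * (\<Sum>k. ?q k)"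
      by (intro mult_left_mono sum_le_suminf sm) (use that(1) in auto)
    finally show ?thesis .
  qed
  have le: "768 / (real m * (real k)\<^sup>2) \<le> 768 / N * ?q k" if "N \<le> m" for m k
  proof (cases "k = 0")
    case False
    have "768 / (real m * (real k)\<^sup>2) \<le> 768 / (real N * (real k)\<^sup>2)"
      using that N False by (intro divide_left_mono mult_right_mono mult_pos_pos) auto
    then show ?thesis by simp
  qed simp
  \<comment> \<open>Above n the smaller index is n, below n it is m; both lie in \<open>A\<close>
    and so are at least \<open>N\<close>. The two sides together give 1536 = 2 * 768.\<close>
  have up: "(\<Sum>m\<in>{m\<in>A. n < m}. cmod (gram n m)) \<le> 768 / N * (\<Sum>k. ?q k)"
  proof (rule sum_le[of _ "\<lambda>m. m - n"])
    fix m assume "m \<in> {m\<in>A. n < m}"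
    then have "cmod (gram (n + (m - n)) n) \<le> 768 / (real n * (real (m - n))\<^sup>2)"
      using n A N by (intro norm_gram_off_diagonal_le) auto
    also have "\<dots> \<le> 768 / N * ?q (m - n)" using n A by (intro le) auto
    finally show "cmod (gram n m) \<le> 768 / N * ?q (m - n)"
      using \<open>m \<in> _\<close> norm_gram_commute[of n m] by simp
  qed (use A in \<open>auto simp: inj_on_def\<close>)
  have down: "(\<Sum>m\<in>{m\<in>A. m < n}. cmod (gram n m)) \<le> 768 / N * (\<Sum>k. ?q k)"
  proof (rule sum_le[of _ "\<lambda>m. n - m"])
    fix m assume "m \<in> {m\<in>A. m < n}"
    then have "cmod (gram (m + (n - m)) m) \<le> 768 / (real m * (real (n - m))\<^sup>2)"
      using n A N by (intro norm_gram_off_diagonal_le) auto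
    also have "\<dots> \<le> 768 / N * ?q (n - m)" using \<open>m \<in> _\<close> A by (intro le) auto
    finally show "cmod (gram n m) \<le> 768 / N * ?q (n - m)"
      using \<open>m \<in> _\<close> by simp
  qed (use A in \<open>auto simp: inj_on_def\<close>)
  have "A - {n} = {m\<in>A. n < m} \<union> {m\<in>A. m < n}" by auto
  then have "(\<Sum>m\<in>A - {n}. cmod (gram n m)) =
      (\<Sum>m\<in>{m\<in>A. n < m}. cmod (gram n m)) + (\<Sum>m\<in>{m\<in>A. m < n}. cmod (gram n m))"
    using A by (simp only:) (intro sum.union_disjoint, auto)
  with up down show ?thesis by simp
qed

text \<open>The diagonal entry is below \<epsilon> / 2 because the diagonal tends to 0, and the rest
  is small because its bound is O(1/N). \<open>N\<close> is independent of \<open>A\<close>, so that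
  Schur's test applies uniformly to all finite blocks.\<close>

lemma gram_row_sums_small:
  assumes "0 < \<epsilon>"
  obtains N where "\<And>A n. finite A \<Longrightarrow> A \<subseteq> {N..} \<Longrightarrow> n \<in> A \<Longrightarrow> (\<Sum>m\<in>A. cmod (gram n m)) \<le> \<epsilon>"
proof -
  let ?K = "1536 * (\<Sum>k. 1 / (real k)\<^sup>2)"
  obtain N1 where N1: "\<And>n. n \<ge> N1 \<Longrightarrow> cmod (gram n n) < \<epsilon> / 2"
    using LIMSEQ_D[OF gram_diagonal_tendsto_0, of "\<epsilon> / 2"] assms by auto
  have "(\<lambda>N. ?K / real N) \<longlonglongrightarrow> 0" by (rule lim_const_over_n)
  then obtain N2 where N2: "\<And>N. N \<ge> N2 \<Longrightarrow> norm (?K / real N - 0) < \<epsilon> / 2"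
    using LIMSEQ_D[of _ _ "\<epsilon> / 2"] assms by (metis half_gt_zero)
  \<comment> \<open>The 4 is the threshold of the off-diagonal estimate.\<close>
  define N where "N = max 4 (max N1 N2)"
  show ?thesis
  proof (rule that[of N])
    fix A n assume A: "finite A" "A \<subseteq> {N..}" "n \<in> A"
    have "(\<Sum>m\<in>A. cmod (gram n m)) = cmod (gram n n) + (\<Sum>m\<in>A - {n}. cmod (gram n m))"
      using A by (intro sum.remove) auto
    also have "\<dots> \<le> \<epsilon> / 2 + ?K / N"
      using A N1[of n] sum_gram_off_diagonal_le[of N A n] by (intro add_mono) (auto simp: N_def)
    also have "?K / N \<le> \<epsilon> / 2"
    proof -
      have "norm (?K / N - 0) < \<epsilon> / 2" by (rule N2) (simp add: N_def)
      then show ?thesis unfolding real_norm_def diff_zero by linarith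
    qed
    finally show "(\<Sum>m\<in>A. cmod (gram n m)) \<le> \<epsilon>" by simp
  qed
qed

text \<open>Schur's test for a Hermitian matrix: after the square is expanded, |d n| |d m| is
  replaced by half the sum of the squares, and the symmetry of the moduli of the entries makes both
  halves the same row sum.\<close>

lemma circle_mean_power_sum_le:
  assumes A: "finite A" and row: "\<And>n. n \<in> A \<Longrightarrow> (\<Sum>m\<in>A. cmod (gram n m)) \<le> \<epsilon>"
  shows "circle_mean (\<lambda>z. (cmod (\<Sum>n\<in>A. d n * twisted_symbol z ^ n))\<^sup>2) 1
    \<le> \<epsilon> * (\<Sum>n\<in>A. (cmod (d n))\<^sup>2)"
proof -
  let ?w = twisted_symbol
  let ?g = "\<lambda>z. \<Sum>n\<in>A. \<Sum>m\<in>A. (d n * cnj (d m)) * (?w z ^ n * cnj (?w z ^ m))"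
  have eq: "of_real ((cmod (\<Sum>n\<in>A. d n * ?w z ^ n))\<^sup>2) = ?g z" for z
    unfolding complex_norm_square cnj_sum sum_product by (simp add: mult_ac)
  have pairs: "?g z = (\<Sum>(n, m)\<in>A \<times> A. (d n * cnj (d m)) * (?w z ^ n * cnj (?w z ^ m)))" for z
    by (simp add: sum.cartesian_product)
  define G where "G p z = ?w z ^ fst p * cnj (?w z ^ snd p)" for p z
  define c where "c p = d (fst p) * cnj (d (snd p))" for p
  have fin: "finite (A \<times> A)" using A by simp
  have G: "circle_integrable (G p) 1" for p
    unfolding G_def[abs_def] by (rule gram_integrable)
  note comb = circle_mean_linear_combination[of "A \<times> A" G 1 c, OF fin G]
  have g: "?g z = (\<Sum>p\<in>A \<times> A. c p * G p z)" for z
    unfolding pairs c_def G_def by (simp add: case_prod_beta)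
  have mean: "circle_mean ?g 1 = (\<Sum>n\<in>A. \<Sum>m\<in>A. (d n * cnj (d m)) * gram n m)"
    unfolding g comb(2) by (simp add: sum.cartesian_product case_prod_beta c_def gram_def G_def[abs_def])
  have int: "circle_integrable ?g 1"
    unfolding g by (rule comb(1))
  have "circle_mean (\<lambda>z. (cmod (\<Sum>n\<in>A. d n * ?w z ^ n))\<^sup>2) 1 = circle_mean (\<lambda>z. Re (?g z)) 1"
    unfolding eq[symmetric] by simp
  also have "\<dots> = Re (\<Sum>n\<in>A. \<Sum>m\<in>A. (d n * cnj (d m)) * gram n m)"
    using Re_circle_mean[OF int] by (simp only: mean)
  also have "\<dots> \<le> (\<Sum>n\<in>A. \<Sum>m\<in>A. cmod (d n) * cmod (d m) * cmod (gram n m))"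
    unfolding Re_sum by (intro sum_mono order_trans[OF complex_Re_le_cmod]) (simp add: norm_mult)
  also have "\<dots> \<le> (\<Sum>n\<in>A. \<Sum>m\<in>A. ((cmod (d n))\<^sup>2 / 2 + (cmod (d m))\<^sup>2 / 2) * cmod (gram n m))"
  proof (intro sum_mono mult_right_mono)
    fix n m
    show "cmod (d n) * cmod (d m) \<le> (cmod (d n))\<^sup>2 / 2 + (cmod (d m))\<^sup>2 / 2"
      using zero_le_power2[of "cmod (d n) - cmod (d m)"] by (simp add: power2_eq_square algebra_simps)
  qed auto
  also have "\<dots> = (\<Sum>n\<in>A. \<Sum>m\<in>A. (cmod (d n))\<^sup>2 / 2 * cmod (gram n m)) +
      (\<Sum>n\<in>A. \<Sum>m\<in>A. (cmod (d m))\<^sup>2 / 2 * cmod (gram n m))"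
    by (simp add: distrib_right sum.distrib)
  also have "(\<Sum>n\<in>A. \<Sum>m\<in>A. (cmod (d m))\<^sup>2 / 2 * cmod (gram n m)) =
      (\<Sum>n\<in>A. \<Sum>m\<in>A. (cmod (d n))\<^sup>2 / 2 * cmod (gram n m))"
    by (subst sum.swap) (simp add: norm_gram_commute)
  also have "(\<Sum>n\<in>A. \<Sum>m\<in>A. (cmod (d n))\<^sup>2 / 2 * cmod (gram n m)) + \<dots> =
      (\<Sum>n\<in>A. (cmod (d n))\<^sup>2 * (\<Sum>m\<in>A. cmod (gram n m)))"
    unfolding sum_distrib_left sum.distrib[symmetric] by (simp add: mult.commute)
  also have "\<dots> \<le> (\<Sum>n\<in>A. (cmod (d n))\<^sup>2 * \<epsilon>)"
    by (intro sum_mono mult_left_mono row) auto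
  finally show ?thesis by (simp add: sum_distrib_left mult.commute)
qed

section \<open>Compactness of composition with the twisted symbol\<close>

lemma cmod_add_power2_le: "(cmod (a + b))\<^sup>2 \<le> 2 * (cmod a)\<^sup>2 + 2 * (cmod b)\<^sup>2"
proof -
  have "(cmod (a + b))\<^sup>2 \<le> (cmod a + cmod b)\<^sup>2"
    by (intro power_mono norm_triangle_ineq) auto
  also have "\<dots> \<le> 2 * (cmod a)\<^sup>2 + 2 * (cmod b)\<^sup>2"
    using zero_le_power2[of "cmod a - cmod b"] by (simp add: power2_eq_square algebra_simps)
  finally show ?thesis .
qed

lemma cmod_diff_power2_le: "(cmod (a - b))\<^sup>2 \<le> 2 * (cmod a)\<^sup>2 + 2 * (cmod b)\<^sup>2"
  using cmod_add_power2_le[of a "- b"] by simp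

text \<open>Cauchy's formula on the circle of radius 1/2 reduces the claim to an exchange of limit
  and integral; \<phi> maps that circle into a compact subset of the disc, where the Taylor series
  of f is dominated.\<close>

lemma taylor_coeff_comp_tendsto:
  assumes f: "f holomorphic_on ball 0 1" and "disc_self_map \<phi>"
  shows "(\<lambda>K. taylor_coeff (\<lambda>z. \<Sum>n<K. taylor_coeff f n * \<phi> z ^ n) j)
    \<longlonglongrightarrow> taylor_coeff (\<lambda>z. f (\<phi> z)) j"
proof -
  have hol\<phi>: "\<phi> holomorphic_on ball 0 1" and self: "\<phi> ` ball 0 1 \<subseteq> ball 0 1"
    using assms(2) by (auto simp: disc_self_map_def)
  let ?F = "\<lambda>K z. \<Sum>n<K. taylor_coeff f n * \<phi> z ^ n"
  have cont\<phi>: "continuous_on (sphere 0 (1 / 2)) \<phi>"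
    using holomorphic_on_imp_continuous_on[OF hol\<phi>] by (rule continuous_on_subset) auto
  have "compact (\<phi> ` sphere 0 (1 / 2))"
    by (intro compact_continuous_image cont\<phi> compact_sphere)
  moreover have "\<phi> ` sphere 0 (1 / 2) \<noteq> {}" by simp
  \<comment> \<open>A point of the image with the largest modulus: the series of absolute values at
    w dominates all partial sums on the circle.\<close>
  ultimately obtain w where w: "w \<in> \<phi> ` sphere 0 (1 / 2)"
    and max: "\<And>v. v \<in> \<phi> ` sphere 0 (1 / 2) \<Longrightarrow> cmod v \<le> cmod w"
    using continuous_attains_sup[of _ cmod] by (metis continuous_on_norm_id)
  have w1: "cmod w < 1" using w self by (force simp: image_subset_iff)
  then obtain q where q: "cmod w < q" "q < 1" using dense by blast
  have "summable (\<lambda>n. taylor_coeff f n * of_real q ^ n)"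
    using taylor_coeff_sums[OF f, of "of_real q"] q norm_ge_zero[of w]
    by (auto simp: sums_iff simp del: norm_ge_zero)
  then have sm: "summable (\<lambda>n. norm (taylor_coeff f n * w ^ n))"
    by (rule powser_insidea) (use q in \<open>auto intro: less_le_trans[OF _ abs_ge_self]\<close>)
  define S where "S = (\<Sum>n. norm (taylor_coeff f n * w ^ n))"
  have half: "of_real (1 / 2) * circle_pt t \<in> sphere 0 (1 / 2)" for t
    by (simp add: norm_mult norm_divide)
  let ?z = "\<lambda>t. of_real (1 / 2) * circle_pt t"
  have 1: "circle_integrable (\<lambda>z. ?F K z / z ^ j) (1 / 2)" for K
    by (intro circle_integrable_continuous continuous_intros cont\<phi>) auto
  have 2: "(\<lambda>t. S * 2 ^ j) integrable_on {0..1::real}"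
    by (rule integrable_const_ivl)
  have 3: "norm (?F K (?z t) / ?z t ^ j) \<le> S * 2 ^ j" for K t
  proof -
    have "norm (?F K (?z t)) \<le> (\<Sum>n<K. norm (taylor_coeff f n * w ^ n))"
      using max half[of t]
      by (intro order_trans[OF norm_sum] sum_mono) (auto simp: norm_mult norm_power intro!: mult_left_mono power_mono)
    also have "\<dots> \<le> S" unfolding S_def by (intro sum_le_suminf sm) auto
    finally show ?thesis
      by (simp add: norm_divide norm_mult norm_power power_divide)
  qed
  have 4: "(\<lambda>K. ?F K (?z t) / ?z t ^ j) \<longlonglongrightarrow> f (\<phi> (?z t)) / ?z t ^ j" for t
  proof (intro tendsto_divide tendsto_const)
    have "?z t \<in> ball 0 1" using half[of t] by simp
    then have "cmod (\<phi> (?z t)) < 1" using self by (auto simp: image_subset_iff)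
    from taylor_coeff_sums[OF f this]
    show "(\<lambda>K. ?F K (?z t)) \<longlonglongrightarrow> f (\<phi> (?z t))" by (simp only: sums_def)
    show "?z t ^ j \<noteq> 0" using half[of t] by (auto simp del: of_real_divide)
  qed
  have "(\<lambda>K. circle_mean (\<lambda>z. ?F K z / z ^ j) (1 / 2)) \<longlonglongrightarrow> circle_mean (\<lambda>z. f (\<phi> z) / z ^ j) (1 / 2)"
    unfolding circle_mean_def by (rule dominated_convergence(2)[OF 1 2 3 4])
  moreover have "?F K holomorphic_on ball 0 1" for K
    by (intro holomorphic_intros hol\<phi>)
  moreover have "(\<lambda>z. f (\<phi> z)) holomorphic_on ball 0 1"
    using holomorphic_on_compose_gen[OF hol\<phi> f self] by (simp add: o_def)
  ultimately show ?thesis by (simp add: circle_mean_taylor_coeff)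
qed

text \<open>Quantitative form of compactness: the first \<open>N\<close> powers are bounded by the
  sup norm and involve finitely many coefficients, the later ones by Schur's test with the small
  factor \<epsilon>. The bound is uniform in the truncation \<open>K\<close>, which is sent to
  infinity at the end.\<close>

lemma sum_taylor_coeff_comp_twisted_symbol_le:
  assumes \<epsilon>: "0 < \<epsilon>"
    and row: "\<And>A n. finite A \<Longrightarrow> A \<subseteq> {N..} \<Longrightarrow> n \<in> A \<Longrightarrow> (\<Sum>m\<in>A. cmod (gram n m)) \<le> \<epsilon>"
    and f: "f holomorphic_on ball 0 1"
    and B: "\<And>K. (\<Sum>n<K. (cmod (taylor_coeff f n))\<^sup>2) \<le> B"
  shows "(\<Sum>j<J. (cmod (taylor_coeff (\<lambda>z. f (twisted_symbol z)) j))\<^sup>2)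
    \<le> 2 * (\<Sum>n<N. cmod (taylor_coeff f n))\<^sup>2 + 2 * \<epsilon> * B"
proof -
  let ?w = twisted_symbol and ?d = "taylor_coeff f"
  define p where "p A z = (\<Sum>n\<in>A. ?d n * ?w z ^ n)" for A z
  define D where "D = (\<Sum>n<N. cmod (?d n))"
  have p_le: "cmod (p A z) \<le> (\<Sum>n\<in>A. cmod (?d n))" if "cmod z \<le> 1" for A z
    unfolding p_def using norm_twisted_symbol_le_1[OF that]
    by (intro order_trans[OF norm_sum] sum_mono) (auto simp: norm_mult norm_power intro!: mult_left_le power_le_one)
  have contp: "continuous_on {z. 1 / 2 \<le> cmod z \<and> cmod z \<le> 1 \<and> z \<noteq> 1} (p A)" for A
    unfolding p_def by (intro continuous_intros continuous_twisted_symbol) auto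
  have int: "circle_integrable (\<lambda>z. (cmod (p A z))\<^sup>2) 1" for A
  proof (rule circle_mean_radial_limit(1))
    show "continuous_on {z. 1 / 2 \<le> cmod z \<and> cmod z \<le> 1 \<and> z \<noteq> 1} (\<lambda>z. (cmod (p A z))\<^sup>2)"
      by (intro continuous_on_power continuous_on_norm contp)
    show "norm ((cmod (p A z))\<^sup>2) \<le> (\<Sum>n\<in>A. cmod (?d n))\<^sup>2" if "cmod z \<le> 1" for z
      unfolding real_norm_def abs_power2 by (intro power_mono p_le that norm_ge_zero)
  qed
  have bound: "(\<Sum>j<J. (cmod (taylor_coeff (p {..<K}) j))\<^sup>2) \<le> 2 * D\<^sup>2 + 2 * \<epsilon> * B" if K: "N \<le> K" for K
  proof -
    have const: "((\<lambda>t. c) has_integral c) {0..1::real}" for c :: real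
      using has_integral_const_real[of c 0 1] by simp
    have "(\<Sum>j<J. (cmod (taylor_coeff (p {..<K}) j))\<^sup>2) \<le> circle_mean (\<lambda>z. (cmod (p {..<K} z))\<^sup>2) 1"
    proof (rule sum_taylor_coeff_le_boundary_mean[OF _ contp p_le])
      show "p {..<K} holomorphic_on ball 0 1"
        unfolding p_def by (intro holomorphic_intros holomorphic_twisted_symbol) auto
    qed
    also have "\<dots> \<le> 2 * D\<^sup>2 + 2 * circle_mean (\<lambda>z. (cmod (p {N..<K} z))\<^sup>2) 1"
      unfolding circle_mean_def
    proof (rule has_integral_le[OF integrable_integral[OF int]])
      show "((\<lambda>t. 2 * D\<^sup>2 + 2 * (cmod (p {N..<K} (of_real 1 * circle_pt t)))\<^sup>2) has_integral
          2 * D\<^sup>2 + 2 * integral {0..1} (\<lambda>t. (cmod (p {N..<K} (of_real 1 * circle_pt t)))\<^sup>2)) {0..1}"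
        by (rule has_integral_add[OF const has_integral_mult_right[OF integrable_integral[OF int]]])
      fix t :: real
      let ?z = "of_real 1 * circle_pt t"
      have "p {..<K} ?z = p {..<N} ?z + p {N..<K} ?z"
        using K by (simp add: p_def lessThan_atLeast0 sum.atLeastLessThan_concat)
      then have "(cmod (p {..<K} ?z))\<^sup>2 \<le> 2 * (cmod (p {..<N} ?z))\<^sup>2 + 2 * (cmod (p {N..<K} ?z))\<^sup>2"
        by (simp only: cmod_add_power2_le)
      moreover have "(cmod (p {..<N} ?z))\<^sup>2 \<le> D\<^sup>2"
        unfolding D_def by (intro power_mono p_le) auto
      ultimately show "(cmod (p {..<K} ?z))\<^sup>2 \<le> 2 * D\<^sup>2 + 2 * (cmod (p {N..<K} ?z))\<^sup>2" by linarith
    qed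
    finally have 1: "(\<Sum>j<J. (cmod (taylor_coeff (p {..<K}) j))\<^sup>2)
        \<le> 2 * D\<^sup>2 + 2 * circle_mean (\<lambda>z. (cmod (p {N..<K} z))\<^sup>2) 1" .
    have "circle_mean (\<lambda>z. (cmod (p {N..<K} z))\<^sup>2) 1 \<le> \<epsilon> * (\<Sum>n\<in>{N..<K}. (cmod (?d n))\<^sup>2)"
      unfolding p_def by (rule circle_mean_power_sum_le) (auto intro!: row)
    also have "\<dots> \<le> \<epsilon> * (\<Sum>n<K. (cmod (?d n))\<^sup>2)"
      using \<epsilon> by (intro mult_left_mono sum_mono2) auto
    also have "\<dots> \<le> \<epsilon> * B" using \<epsilon> by (intro mult_left_mono B) auto
    finally show ?thesis using 1 by linarith
  qed
  have "(\<lambda>K. \<Sum>j<J. (cmod (taylor_coeff (p {..<K}) j))\<^sup>2) \<longlonglongrightarrow>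
      (\<Sum>j<J. (cmod (taylor_coeff (\<lambda>z. f (?w z)) j))\<^sup>2)"
    unfolding p_def
    by (intro tendsto_sum tendsto_power tendsto_norm taylor_coeff_comp_tendsto f disc_self_map_twisted_symbol)
  from LIMSEQ_le_const2[OF this] bound show ?thesis unfolding D_def by blast
qed

section \<open>Norm bounds from partial sums and the compactness argument\<close>

lemma in_H2_partial_sum_le:
  assumes "in_H2 f" "H2_norm f \<le> 1"
  shows "(\<Sum>n<K. (cmod (taylor_coeff f n))\<^sup>2) \<le> 1"
proof -
  have "(\<Sum>n<K. (cmod (taylor_coeff f n))\<^sup>2) \<le> (\<Sum>n. (cmod (taylor_coeff f n))\<^sup>2)"
    using assms(1) by (intro sum_le_suminf) (auto simp: in_H2_def)
  also have "\<dots> \<le> 1" using assms(2) by (simp add: H2_norm_def)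
  finally show ?thesis .
qed

text \<open>Bounded partial sums also yield summability, without which the infinite sum in
  \<open>H2_norm\<close> is unspecified.\<close>

lemma H2_norm_le:
  assumes "0 \<le> C" "\<And>J. (\<Sum>j<J. (cmod (taylor_coeff f j))\<^sup>2) \<le> C\<^sup>2"
  shows "H2_norm f \<le> C"
proof -
  have "summable (\<lambda>j. (cmod (taylor_coeff f j))\<^sup>2)"
    by (rule summableI_nonneg_bounded) (use assms in auto)
  then have "(\<Sum>j. (cmod (taylor_coeff f j))\<^sup>2) \<le> C\<^sup>2"
    by (rule suminf_le_const) (use assms in auto)
  then show ?thesis
    using assms(1) by (simp add: H2_norm_def real_le_lsqrt)
qed

text \<open>Realises a coefficientwise limit as a holomorphic function, by comparison with the
  geometric series.\<close>

lemma bounded_coeff_power_series: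
  fixes b :: "nat \<Rightarrow> complex"
  assumes "\<And>n. cmod (b n) \<le> 1"
  obtains h where "h holomorphic_on ball 0 1" "taylor_coeff h = b"
proof
  let ?h = "\<lambda>z. \<Sum>n. b n * z ^ n"
  have s: "(\<lambda>n. b n * z ^ n) sums ?h z" if "cmod z < 1" for z
  proof (rule summable_sums, rule summable_comparison_test)
    show "\<exists>N. \<forall>n\<ge>N. norm (b n * z ^ n) \<le> cmod z ^ n"
      using assms by (auto simp: norm_mult norm_power intro!: mult_left_le_one_le)
    show "summable (\<lambda>n. cmod z ^ n)" using that by (intro summable_geometric) auto
  qed
  show "?h holomorphic_on ball 0 1" by (rule holomorphic_unit_disc_powerI[OF s])
  show "taylor_coeff ?h = b" by (rule ext, rule taylor_coeff_eqI[OF s])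
qed

text \<open>A diagonal subsequence converges coefficientwise to the coefficients of some
  \<open>h\<close>. The differences \<open>d n\<close> stay bounded in norm while each of their
  coefficients tends to 0, so the estimate by a finite head and a small tail makes their
  compositions tend to 0 in norm.\<close>

lemma compact_comp_twisted_symbol: "compact_comp_H2 twisted_symbol"
  unfolding compact_comp_H2_def
proof (intro allI impI)
  fix f :: "nat \<Rightarrow> complex \<Rightarrow> complex"
  assume f: "\<forall>n. in_H2 (f n) \<and> H2_norm (f n) \<le> 1"
  let ?w = twisted_symbol
  have fh: "f n holomorphic_on ball 0 1" for n using f by (simp add: in_H2_def)
  have sum_f: "(\<Sum>j<K. (cmod (taylor_coeff (f n) j))\<^sup>2) \<le> 1" for n K
    using f by (intro in_H2_partial_sum_le) auto
  have f_le: "cmod (taylor_coeff (f n) j) \<le> 1" for n j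
  proof -
    have "(cmod (taylor_coeff (f n) j))\<^sup>2 \<le> (\<Sum>i<Suc j. (cmod (taylor_coeff (f n) i))\<^sup>2)"
      by (simp add: sum_nonneg)
    also note sum_f
    finally show ?thesis by (simp add: abs_square_le_1)
  qed
  obtain r where r: "strict_mono (r :: nat \<Rightarrow> nat)"
    and "\<And>j. \<exists>l. (\<lambda>n. taylor_coeff (f (r n)) j) \<longlonglongrightarrow> l"
    using function_convergent_subsequence[of "UNIV :: nat set" "\<lambda>n. taylor_coeff (f n)" 1] f_le
    by auto
  then obtain b where b: "\<And>j. (\<lambda>n. taylor_coeff (f (r n)) j) \<longlonglongrightarrow> b j" by metis
  have sum_b: "(\<Sum>j<K. (cmod (b j))\<^sup>2) \<le> 1" for K
    by (rule LIMSEQ_le_const2[of "\<lambda>n. \<Sum>j<K. (cmod (taylor_coeff (f (r n)) j))\<^sup>2"])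
      (auto intro!: tendsto_sum tendsto_power tendsto_norm b sum_f)
  have b_le: "cmod (b j) \<le> 1" for j
    by (rule LIMSEQ_le_const2[OF tendsto_norm[OF b]]) (auto simp: f_le)
  obtain h where h: "h holomorphic_on ball 0 1" and coeff_h: "taylor_coeff h = b"
    using bounded_coeff_power_series[of b] b_le by blast
  define g where "g z = h (?w z)" for z
  have "in_H2 g"
    unfolding in_H2_def
  proof
    have "?w holomorphic_on ball 0 1" "?w ` ball 0 1 \<subseteq> ball 0 1"
      using disc_self_map_twisted_symbol by (auto simp: disc_self_map_def)
    from holomorphic_on_compose_gen[OF this(1) h this(2)]
    show "g holomorphic_on ball 0 1" by (simp add: g_def[abs_def] o_def)
    \<comment> \<open>For membership in H^2 any finite bound will do, so row sums at most 1
      suffice.\<close>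
    obtain N where row: "\<And>A n. finite A \<Longrightarrow> A \<subseteq> {N..} \<Longrightarrow> n \<in> A \<Longrightarrow> (\<Sum>m\<in>A. cmod (gram n m)) \<le> 1"
      using gram_row_sums_small[of 1] by auto
    show "summable (\<lambda>n. (cmod (taylor_coeff g n))\<^sup>2)"
    proof (rule summableI_nonneg_bounded)
      show "(\<Sum>j<J. (cmod (taylor_coeff g j))\<^sup>2)
          \<le> 2 * (\<Sum>n<N. cmod (taylor_coeff h n))\<^sup>2 + 2 * 1 * 1" for J
        unfolding g_def[abs_def]
        by (rule sum_taylor_coeff_comp_twisted_symbol_le[OF _ row h]) (auto simp: coeff_h sum_b)
    qed auto
  qed
  moreover have "(\<lambda>n. H2_norm (\<lambda>z. f (r n) (?w z) - g z)) \<longlonglongrightarrow> 0"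
  proof (rule LIMSEQ_I)
    fix e :: real
    assume e: "0 < e"
    define d where "d n z = f (r n) z - h z" for n z
    have dh: "d n holomorphic_on ball 0 1" for n
      unfolding d_def by (intro holomorphic_intros fh h)
    have dc: "taylor_coeff (d n) j = taylor_coeff (f (r n)) j - b j" for n j
      using taylor_coeff_diff[OF fh h, of "r n" j] by (simp add: d_def[abs_def] coeff_h)
    have dB: "(\<Sum>j<K. (cmod (taylor_coeff (d n) j))\<^sup>2) \<le> 4" for n K
    proof -
      have "(\<Sum>j<K. (cmod (taylor_coeff (d n) j))\<^sup>2)
          \<le> (\<Sum>j<K. 2 * (cmod (taylor_coeff (f (r n)) j))\<^sup>2 + 2 * (cmod (b j))\<^sup>2)"
        unfolding dc by (intro sum_mono cmod_diff_power2_le)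
      also have "\<dots> = 2 * (\<Sum>j<K. (cmod (taylor_coeff (f (r n)) j))\<^sup>2) + 2 * (\<Sum>j<K. (cmod (b j))\<^sup>2)"
        by (simp add: sum.distrib sum_distrib_left)
      also have "\<dots> \<le> 4" using sum_f[of "r n" K] sum_b[of K] by simp
      finally show ?thesis .
    qed
    \<comment> \<open>The 32 makes the tail term 2 * (e^2 / 32) * 4 equal to e^2 / 4, with 4 the
      bound from \<open>dB\<close>.\<close>
    have e32: "0 < e\<^sup>2 / 32" using e by simp
    obtain N where row: "\<And>A n. finite A \<Longrightarrow> A \<subseteq> {N..} \<Longrightarrow> n \<in> A \<Longrightarrow> (\<Sum>m\<in>A. cmod (gram n m)) \<le> e\<^sup>2 / 32"
      using gram_row_sums_small[OF e32] by auto
    have "(\<lambda>n. 2 * (\<Sum>j<N. cmod (taylor_coeff (f (r n)) j - b j))\<^sup>2) \<longlonglongrightarrow>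
        2 * (\<Sum>j<N. cmod (b j - b j))\<^sup>2"
      by (intro tendsto_intros b)
    then have "(\<lambda>n. 2 * (\<Sum>j<N. cmod (taylor_coeff (d n) j))\<^sup>2) \<longlonglongrightarrow> 0"
      by (simp add: dc)
    from order_tendstoD(2)[OF this, of "e\<^sup>2 / 4"] e
    have "eventually (\<lambda>n. 2 * (\<Sum>j<N. cmod (taylor_coeff (d n) j))\<^sup>2 < e\<^sup>2 / 4) sequentially"
      by simp
    then obtain n0 where n0: "\<And>n. n \<ge> n0 \<Longrightarrow> 2 * (\<Sum>j<N. cmod (taylor_coeff (d n) j))\<^sup>2 < e\<^sup>2 / 4"
      by (auto simp: eventually_sequentially)
    have "norm (H2_norm (\<lambda>z. f (r n) (?w z) - g z) - 0) < e" if "n \<ge> n0" for n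
    proof -
      have eq: "(\<lambda>z. f (r n) (?w z) - g z) = (\<lambda>z. d n (?w z))"
        by (simp add: d_def g_def)
      have "H2_norm (\<lambda>z. d n (?w z)) \<le> sqrt (1 / 2) * e"
      proof (rule H2_norm_le)
        fix J
        have "(\<Sum>j<J. (cmod (taylor_coeff (\<lambda>z. d n (?w z)) j))\<^sup>2)
            \<le> 2 * (\<Sum>j<N. cmod (taylor_coeff (d n) j))\<^sup>2 + 2 * (e\<^sup>2 / 32) * 4"
          by (rule sum_taylor_coeff_comp_twisted_symbol_le[OF e32 row dh dB])
        also have "\<dots> \<le> e\<^sup>2 / 4 + e\<^sup>2 / 4" using n0[OF that] by simp
        finally show "(\<Sum>j<J. (cmod (taylor_coeff (\<lambda>z. d n (?w z)) j))\<^sup>2) \<le> (sqrt (1 / 2) * e)\<^sup>2"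
          by (simp add: power_mult_distrib)
      qed (use e in auto)
      also have "\<dots> < 1 * e"
        using e by (intro mult_strict_right_mono) (auto simp: real_less_lsqrt)
      finally have "H2_norm (\<lambda>z. d n (?w z)) < e" by simp
      \<comment> \<open>Nonnegativity, used to drop the absolute value, rests on
        summability.\<close>
      moreover have "0 \<le> H2_norm (\<lambda>z. d n (?w z))"
      proof -
        have "summable (\<lambda>j. (cmod (taylor_coeff (\<lambda>z. d n (?w z)) j))\<^sup>2)"
          by (rule summableI_nonneg_bounded[OF _ sum_taylor_coeff_comp_twisted_symbol_le[OF e32 row dh dB]]) auto
        then show ?thesis by (simp add: H2_norm_def suminf_nonneg)
      qed
      ultimately show ?thesis unfolding eq by simp
    qed
    then show "\<exists>n0. \<forall>n\<ge>n0. norm (H2_norm (\<lambda>z. f (r n) (?w z) - g z) - 0) < e" by blast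
  qed
  ultimately show "\<exists>r g. strict_mono r \<and> in_H2 g \<and>
      (\<lambda>n. H2_norm (\<lambda>z. f (r n) (?w z) - g z)) \<longlonglongrightarrow> 0"
    using r by blast
qed

section \<open>Non-compactness of composition with the affine symbol\<close>

text \<open>These are the multiples of the reproducing kernel at the real point a, expanded as
  geometric series.\<close>

lemma geometric_taylor_coeff:
  assumes "0 \<le> a" "a < 1"
  shows "taylor_coeff (\<lambda>z. c / (1 - of_real a * z)) n = c * of_real a ^ n"
    and "(\<lambda>z. c / (1 - of_real a * z)) holomorphic_on ball 0 1"
proof -
  have s: "(\<lambda>n. c * of_real a ^ n * z ^ n) sums (c / (1 - of_real a * z))" if "cmod z < 1" for z
  proof -
    have "a * cmod z < 1"
      using mult_left_le[of "cmod z" a] assms that by simp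
    then have "cmod (of_real a * z) < 1" using assms by (simp add: norm_mult)
    from sums_mult[OF geometric_sums[OF this], of c] show ?thesis
      by (simp add: power_mult_distrib mult_ac)
  qed
  show "taylor_coeff (\<lambda>z. c / (1 - of_real a * z)) n = c * of_real a ^ n"
    by (rule taylor_coeff_eqI[OF s])
  show "(\<lambda>z. c / (1 - of_real a * z)) holomorphic_on ball 0 1"
    by (rule holomorphic_unit_disc_powerI[OF s])
qed

lemma geometric_norm_sums:
  assumes "0 \<le> a" "a < 1"
  shows "(\<lambda>n. (cmod (c * of_real a ^ n))\<^sup>2) sums ((cmod c)\<^sup>2 / (1 - a\<^sup>2))"
proof -
  have "norm (a\<^sup>2) < 1" using assms by (simp add: power_less_one_iff abs_square_less_1)
  from sums_mult[OF geometric_sums[OF this], of "(cmod c)\<^sup>2"] show ?thesis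
    using assms by (simp add: norm_mult norm_power power_mult_distrib power_mult[symmetric] mult.commute)
qed

text \<open>A sum of squares dominates each of its terms. Thus norm convergence forces
  coefficientwise convergence.\<close>

lemma cmod_taylor_coeff_le_H2_norm:
  assumes "summable (\<lambda>n. (cmod (taylor_coeff f n))\<^sup>2)"
  shows "cmod (taylor_coeff f j) \<le> H2_norm f"
proof -
  have "(cmod (taylor_coeff f j))\<^sup>2 \<le> (\<Sum>n. (cmod (taylor_coeff f n))\<^sup>2)"
    using sum_le_suminf[OF assms, of "{j}"] by simp
  then show ?thesis by (simp add: H2_norm_def real_le_rsqrt)
qed

text \<open>Pulling out the value at z = 0 of the composed denominator leaves the denominator of
  another kernel, at a / (2 - a).\<close>

lemma affine_kernel_identity:
  fixes a z :: complex
  assumes "2 - a \<noteq> 0"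
  shows "1 - a * ((1 + z) / 2) = (2 - a) / 2 * (1 - a / (2 - a) * z)"
proof -
  have "(2 - a) / 2 * (1 - a / (2 - a) * z) = (2 - a) / 2 - (2 - a) / 2 * (a / (2 - a) * z)"
    by (simp only: right_diff_distrib mult_1_right)
  also have "(2 - a) / 2 * (a / (2 - a) * z) = a * z / 2"
  proof -
    have "q \<noteq> 0 \<Longrightarrow> q / 2 * (a / q * z) = a * z / 2" for q by simp
    from this[OF assms] show ?thesis .
  qed
  finally show ?thesis by (simp add: diff_divide_distrib add_divide_distrib distrib_left)
qed

text \<open>With p = 2 - a, the factor 1 - a in p^2 - a^2 = 4 (1 - a) cancels the one in 1 - a^2.
  The left side is the squared norm of the composed normalised kernel, which thus stays away from
  0.\<close>

lemma kernel_norm_identity: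
  fixes a :: real
  assumes "0 \<le> a" "a < 1"
  shows "(sqrt (1 - a\<^sup>2) / (1 - a / 2))\<^sup>2 / (1 - (a / (2 - a))\<^sup>2) = 1 + a"
proof -
  define p where "p = 2 - a"
  have p: "p \<noteq> 0" using assms by (simp add: p_def)
  have a2: "a\<^sup>2 < 1" using assms by (simp add: abs_square_less_1)
  have half: "1 - a / 2 = p / 2" by (simp add: p_def diff_divide_distrib)
  have 1: "(sqrt (1 - a\<^sup>2) / (1 - a / 2))\<^sup>2 = 4 * (1 - a\<^sup>2) / p\<^sup>2"
    unfolding half using a2 by (simp add: power_divide)
  have "p\<^sup>2 - a\<^sup>2 = 4 * (1 - a)"
    by (simp add: p_def power2_eq_square algebra_simps)
  moreover have "1 - (a / p)\<^sup>2 = (p\<^sup>2 - a\<^sup>2) / p\<^sup>2"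
    using p by (simp add: power_divide diff_divide_distrib)
  ultimately have 2: "1 - (a / (2 - a))\<^sup>2 = 4 * (1 - a) / p\<^sup>2"
    by (simp add: p_def)
  have "1 - a\<^sup>2 = (1 - a) * (1 + a)" by (simp add: power2_eq_square algebra_simps)
  moreover have "1 - a \<noteq> 0" using assms by simp
  ultimately show ?thesis unfolding 1 2 using p by (simp del: right_diff_distrib_numeral)
qed

text \<open>The normalised kernel at \<open>a\<close> is mapped to a multiple of the kernel at \<open>a / (2 - a)\<close>, of squared
  norm \<open>1 + a\<close>; letting \<open>a\<close> tend to 1 gives a coefficientwise null sequence that is not norm null.\<close>

lemma not_compact_comp_affine_symbol: "\<not> compact_comp_H2 affine_symbol"
proof
  assume compact: "compact_comp_H2 affine_symbol"
  define a where "a = radii"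
  define s where "s n = sqrt (1 - (a n)\<^sup>2)" for n
  define k where "k n z = of_real (s n) / (1 - of_real (a n) * z)" for n and z :: complex
  define v where "v n = a n / (2 - a n)" for n
  define \<alpha> where "\<alpha> n = s n / (1 - a n / 2)" for n
  have a: "0 \<le> a n" "a n < 1" for n
    using radii_bounds[of n] by (auto simp: a_def)
  have a2: "(a n)\<^sup>2 < 1" for n using a[of n] by (simp add: abs_square_less_1)
  have s2: "(s n)\<^sup>2 = 1 - (a n)\<^sup>2" for n using a2[of n] by (simp add: s_def)
  have v: "0 \<le> v n" "v n < 1" for n using a[of n] by (auto simp: v_def)
  have k_coeff: "taylor_coeff (k n) j = of_real (s n) * of_real (a n) ^ j" for n j
    unfolding k_def using geometric_taylor_coeff(1)[OF a] by simp
  have "in_H2 (k n) \<and> H2_norm (k n) \<le> 1" for n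
  proof -
    have "(\<lambda>j. (cmod (taylor_coeff (k n) j))\<^sup>2) sums 1"
      using geometric_norm_sums[OF a, of "of_real (s n)" n] a2[of n]
      unfolding k_coeff by (simp add: s2)
    moreover have "k n holomorphic_on ball 0 1"
      unfolding k_def by (rule geometric_taylor_coeff(2)[OF a])
    ultimately show ?thesis
      unfolding in_H2_def H2_norm_def by (simp add: sums_summable sums_unique[symmetric])
  qed
  then obtain r g where r: "strict_mono (r :: nat \<Rightarrow> nat)" and g: "in_H2 g"
    and lim: "(\<lambda>n. H2_norm (\<lambda>z. k (r n) (affine_symbol z) - g z)) \<longlonglongrightarrow> 0"
    using compact unfolding compact_comp_H2_def by blast
  have comp: "k n (affine_symbol z) = of_real (\<alpha> n) / (1 - of_real (v n) * z)" for n z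
  proof -
    have ne: "2 - complex_of_real (a n) \<noteq> 0"
    proof
      assume "2 - complex_of_real (a n) = 0"
      then have "Re (2 - complex_of_real (a n)) = Re 0" by (rule arg_cong)
      then show False using a(2)[of n] by simp
    qed
    have "1 - of_real (a n) * affine_symbol z = (2 - of_real (a n)) / 2 * (1 - of_real (v n) * z)"
      using affine_kernel_identity[OF ne] by (simp add: affine_symbol_def v_def)
    moreover have "complex_of_real (\<alpha> n) = of_real (s n) / ((2 - of_real (a n)) / 2)"
    proof -
      have "\<alpha> n = s n / ((2 - a n) / 2)" by (simp add: \<alpha>_def diff_divide_distrib)
      then show ?thesis by simp
    qed
    ultimately show ?thesis unfolding k_def by (simp only: divide_divide_eq_left)
  qed
  have gh: "g holomorphic_on ball 0 1" using g by (simp add: in_H2_def)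
  let ?D = "\<lambda>n z. k (r n) (affine_symbol z) - g z"
  have D_coeff: "taylor_coeff (?D n) j = of_real (\<alpha> (r n)) * of_real (v (r n)) ^ j - taylor_coeff g j" for n j
    unfolding comp taylor_coeff_diff[OF geometric_taylor_coeff(2)[OF v] gh]
    by (simp add: geometric_taylor_coeff(1)[OF v])
  \<comment> \<open>\<open>H2_norm\<close> controls single coefficients only when they are
    square-summable.\<close>
  have D_summable: "summable (\<lambda>j. (cmod (taylor_coeff (?D n) j))\<^sup>2)" for n
  proof (rule summable_comparison_test)
    let ?b = "\<lambda>j. 2 * (cmod (of_real (\<alpha> (r n)) * of_real (v (r n)) ^ j))\<^sup>2 + 2 * (cmod (taylor_coeff g j))\<^sup>2"
    show "\<exists>N. \<forall>j\<ge>N. norm ((cmod (taylor_coeff (?D n) j))\<^sup>2) \<le> ?b j"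
      unfolding D_coeff real_norm_def abs_power2 using cmod_diff_power2_le by blast
    show "summable ?b"
      using g sums_summable[OF geometric_norm_sums[OF v]]
      by (intro summable_add summable_mult) (auto simp: in_H2_def)
  qed
  have "a \<longlonglongrightarrow> 1" unfolding a_def by (rule radii_tendsto)
  \<comment> \<open>Although the norms stay away from 0, the prefactor vanishes in the limit, so
    every single coefficient tends to 0.\<close>
  then have "\<alpha> \<longlonglongrightarrow> sqrt (1 - 1\<^sup>2) / (1 - 1 / 2)"
    unfolding \<alpha>_def s_def by (intro tendsto_intros) auto
  then have "\<alpha> \<longlonglongrightarrow> 0" by simp
  then have \<alpha>r: "(\<lambda>n. \<alpha> (r n)) \<longlonglongrightarrow> 0"
    using LIMSEQ_subseq_LIMSEQ[OF _ r, of \<alpha> 0] by (simp add: o_def)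
  \<comment> \<open>As the limit in norm, g must have the coefficientwise limits, all of them 0, as
    its coefficients.\<close>
  have g0: "taylor_coeff g j = 0" for j
  proof -
    have "(\<lambda>n. of_real (\<alpha> (r n)) * complex_of_real (v (r n)) ^ j) \<longlonglongrightarrow> 0"
    proof (rule Lim_null_comparison)
      show "\<forall>\<^sub>F n in sequentially. norm (of_real (\<alpha> (r n)) * complex_of_real (v (r n)) ^ j) \<le> \<bar>\<alpha> (r n)\<bar>"
        using v less_imp_le[OF v(2)]
        by (auto simp: norm_mult norm_power intro!: always_eventually mult_left_le power_le_one)
      show "(\<lambda>n. \<bar>\<alpha> (r n)\<bar>) \<longlonglongrightarrow> 0" using \<alpha>r by (rule tendsto_rabs_zero)
    qed
    then have "(\<lambda>n. taylor_coeff (?D n) j) \<longlonglongrightarrow> 0 - taylor_coeff g j"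
      unfolding D_coeff by (intro tendsto_diff tendsto_const)
    moreover have "(\<lambda>n. taylor_coeff (?D n) j) \<longlonglongrightarrow> 0"
      by (rule Lim_null_comparison[OF _ lim])
        (auto intro!: always_eventually cmod_taylor_coeff_le_H2_norm D_summable)
    ultimately have "0 - taylor_coeff g j = 0" by (rule LIMSEQ_unique)
    then show ?thesis by simp
  qed
  have "1 \<le> H2_norm (?D n)" for n
  proof -
    let ?a = "a (r n)"
    have "(\<lambda>j. (cmod (taylor_coeff (?D n) j))\<^sup>2) sums ((\<alpha> (r n))\<^sup>2 / (1 - (v (r n))\<^sup>2))"
      using geometric_norm_sums[OF v, of "of_real (\<alpha> (r n))" "r n"]
      unfolding D_coeff g0 by simp
    moreover have "(\<alpha> (r n))\<^sup>2 / (1 - (v (r n))\<^sup>2) = 1 + ?a"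
      unfolding \<alpha>_def v_def s_def by (rule kernel_norm_identity[OF a])
    ultimately have "H2_norm (?D n) = sqrt (1 + ?a)"
      unfolding H2_norm_def by (simp only: sums_unique[symmetric])
    then show ?thesis using a[of "r n"] by simp
  qed
  then have "1 \<le> (0::real)"
    using lim by (intro LIMSEQ_le_const) auto
  then show False by simp
qed

section \<open>Radial limits\<close>

lemma radial_limit:
  assumes "isCont f (cis t)"
  shows "((\<lambda>r. f (of_real r * cis t)) \<longlongrightarrow> f (cis t)) (at_left 1)"
proof (rule isCont_tendsto_compose[OF assms])
  have "((\<lambda>r. of_real r * cis t) \<longlongrightarrow> of_real 1 * cis t) (at_left (1::real))"
    by (intro tendsto_intros)
  then show "((\<lambda>r. of_real r * cis t) \<longlongrightarrow> cis t) (at_left (1::real))" by simp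
qed

theorem mainTheorem3:
  shows "\<exists>\<phi>1 \<phi>2 :: complex \<Rightarrow> complex.
     disc_self_map \<phi>1 \<and> disc_self_map \<phi>2 \<and>
     (AE t in lborel. t \<in> {0..2*pi} \<longrightarrow>
        (\<exists>a b. ((\<lambda>r. \<phi>1 (of_real r * cis t)) \<longlongrightarrow> a) (at_left 1) \<and>
               ((\<lambda>r. \<phi>2 (of_real r * cis t)) \<longlongrightarrow> b) (at_left 1) \<and>
               cmod a = cmod b)) \<and>
     compact_comp_H2 \<phi>2 \<and> \<not> compact_comp_H2 \<phi>1"
proof (intro exI conjI)
  \<comment> \<open>Both exceptional angles give the point 1, where \<open>twisted_symbol\<close>
    has an essential singularity.\<close>
  have "AE t in lborel. t \<notin> {0, 2 * pi}"
    by (intro AE_not_in countable_imp_null_set_lborel) auto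
  \<comment> \<open>This goal fixes the witnesses left open by \<open>exI\<close>.\<close>
  then show "AE t in lborel. t \<in> {0..2*pi} \<longrightarrow>
        (\<exists>a b. ((\<lambda>r. affine_symbol (of_real r * cis t)) \<longlongrightarrow> a) (at_left 1) \<and>
               ((\<lambda>r. twisted_symbol (of_real r * cis t)) \<longlongrightarrow> b) (at_left 1) \<and>
               cmod a = cmod b)"
  proof (rule AE_mp, intro AE_I2 impI)
    fix t :: real
    assume "t \<notin> {0, 2 * pi}" "t \<in> {0..2 * pi}"
    then have "circle_pt (t / (2 * pi)) \<noteq> 1"
      by (intro circle_pt_neq_1) auto
    then have t: "cis t \<noteq> 1" by (simp add: circle_pt_def)
    \<comment> \<open>Both symbols are holomorphic off 1, so their radial limits are their values on
      the circle.\<close>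
    have hol: "isCont f (cis t)" if "f holomorphic_on - {1}" for f :: "complex \<Rightarrow> complex"
    proof -
      have "open (- {1 :: complex})" by (intro open_Compl closed_singleton)
      then show ?thesis
        using holomorphic_on_imp_continuous_on[OF that] t
        by (simp add: continuous_on_eq_continuous_at)
    qed
    have "cmod (affine_symbol (cis t)) = cmod (twisted_symbol (cis t))"
      by (simp add: twisted_symbol_def norm_mult norm_singular_inner_circle)
    then show "\<exists>a b. ((\<lambda>r. affine_symbol (of_real r * cis t)) \<longlongrightarrow> a) (at_left 1) \<and>
               ((\<lambda>r. twisted_symbol (of_real r * cis t)) \<longlongrightarrow> b) (at_left 1) \<and> cmod a = cmod b"
      using radial_limit[OF hol[OF holomorphic_affine_symbol]]
        radial_limit[OF hol[OF holomorphic_twisted_symbol]] by blast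
  qed
qed (rule disc_self_map_affine_symbol disc_self_map_twisted_symbol
    compact_comp_twisted_symbol not_compact_comp_affine_symbol)+

end
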